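(* A slice-open set $\Omega\subset\mathbb{H}$ is a domain of slice regularity if and only if for every $I\in\mathbb{S}$ there are no open sets $U_1$ and $U_2$ in $\mathbb{C}_I$ such that $(\Omega,U_1,U_2)$ is an $I$-triple.
   Context: $\mathbb{H}$ denotes the quaternions, $\mathbb{S}=\{q\in\mathbb{H}: q^2=-1\}$, $\mathbb{C}_I=\mathbb{R}+I\mathbb{R}$ for $I\in\mathbb{S}$, and $\Omega_I:=\Omega\cap\mathbb{C}_I$. A set $\Omega\subset\mathbb{H}$ is slice-open if $\Omega_I$ is open in $\mathbb{C}_I$ for every $I\in\mathbb{S}$; slice-open sets form the slice topology on $\mathbb{H}$, and slice-connected means connected in this topology. For $U$ open in $\mathbb{C}_I$, $h:U\to\mathbb{H}$ is (left $\mathbb{C}_I$-)holomorphic if it has continuous partial derivatives and $\frac12\left(\frac{\partial}{\partial x}+I\frac{\partial}{\partial y}\right)h(x+yI)=0$ on $U$. A function $f:\Omega\to\mathbb{H}$ on a slice-open set is slice regular if $f|_{\Omega_I}$ is left $\mathbb{C}_I$-holomorphic for every $I\in\mathbb{S}$. A slice-open set $\Omega$ is a domain of slice regularity if there are no slice-open sets $\Omega_1,\Omega_2$ in $\mathbb{H}$ such that: (i) $\varnothing\neq\Omega_1\subset\Omega_2\cap\Omega$; (ii) $\Omega_2$ is slice-connected and not contained in $\Omega$; (iii) for every slice regular function $f$ on $\Omega$ there is a slice regular function $\widetilde f$ on $\Omega_2$ with $f=\widetilde f$ on $\Omega_1$. For $\Omega$ slice-open, $I\in\mathbb{S}$ and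 $U_1,U_2$ open in $\mathbb{C}_I$, $(\Omega,U_1,U_2)$ is an $I$-triple if: (i) $\varnothing\neq U_1\subset U_2\cap\Omega_I$; (ii) $U_2$ is connected in $\mathbb{C}_I$ and not contained in $\Omega_I$; (iii) for every slice regular function $f$ on $\Omega$ there is a holomorphic function $\widetilde f:U_2\to\mathbb{H}$ with $f=\widetilde f$ on $U_1$. *)

theory Defs
  imports "HOL-Analysis.Analysis"
begin

section \<open>The real algebra of quaternions\<close>

datatype quat = Quat (qre: real) (qim1: real) (qim2: real) (qim3: real)

lemma quat_eq_iff:
  "p = q \<longleftrightarrow> qre p = qre q \<and> qim1 p = qim1 q \<and> qim2 p = qim2 q \<and> qim3 p = qim3 q"
  by (auto intro: quat.expand)

instantiation quat :: ring_1
begin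

definition "0 = Quat 0 0 0 0"
definition "1 = Quat 1 0 0 0"
definition "p + q = Quat (qre p + qre q) (qim1 p + qim1 q) (qim2 p + qim2 q) (qim3 p + qim3 q)"
definition "p - q = Quat (qre p - qre q) (qim1 p - qim1 q) (qim2 p - qim2 q) (qim3 p - qim3 q)"
definition "- q = Quat (- qre q) (- qim1 q) (- qim2 q) (- qim3 q)"
definition "p * q = Quat
  (qre p * qre q - qim1 p * qim1 q - qim2 p * qim2 q - qim3 p * qim3 q)
  (qre p * qim1 q + qim1 p * qre q + qim2 p * qim3 q - qim3 p * qim2 q)
  (qre p * qim2 q - qim1 p * qim3 q + qim2 p * qre q + qim3 p * qim1 q)
  (qre p * qim3 q + qim1 p * qim2 q - qim2 p * qim1 q + qim3 p * qre q)"

instance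
  by standard
    (auto simp: zero_quat_def one_quat_def plus_quat_def minus_quat_def uminus_quat_def
      times_quat_def quat_eq_iff algebra_simps)

end

lemma quat_sel_simps [simp]:
  "qre 0 = 0" "qim1 0 = 0" "qim2 0 = 0" "qim3 0 = 0"
  "qre 1 = 1" "qim1 1 = 0" "qim2 1 = 0" "qim3 1 = 0"
  "qre (p + q) = qre p + qre q" "qim1 (p + q) = qim1 p + qim1 q"
  "qim2 (p + q) = qim2 p + qim2 q" "qim3 (p + q) = qim3 p + qim3 q"
  "qre (p - q) = qre p - qre q" "qim1 (p - q) = qim1 p - qim1 q"
  "qim2 (p - q) = qim2 p - qim2 q" "qim3 (p - q) = qim3 p - qim3 q"
  "qre (- q) = - qre q" "qim1 (- q) = - qim1 q" "qim2 (- q) = - qim2 q" "qim3 (- q) = - qim3 q"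
  by (simp_all add: zero_quat_def one_quat_def plus_quat_def minus_quat_def uminus_quat_def)

lemma quat_mult_sel:
  "qre (p * q) = qre p * qre q - qim1 p * qim1 q - qim2 p * qim2 q - qim3 p * qim3 q"
  "qim1 (p * q) = qre p * qim1 q + qim1 p * qre q + qim2 p * qim3 q - qim3 p * qim2 q"
  "qim2 (p * q) = qre p * qim2 q - qim1 p * qim3 q + qim2 p * qre q + qim3 p * qim1 q"
  "qim3 (p * q) = qre p * qim3 q + qim1 p * qim2 q - qim2 p * qim1 q + qim3 p * qre q"
  by (simp_all add: times_quat_def)

instantiation quat :: real_algebra_1
begin

definition "r *\<^sub>R q = Quat (r * qre q) (r * qim1 q) (r * qim2 q) (r * qim3 q)"

instance
  by standard (auto simp: scaleR_quat_def quat_eq_iff quat_mult_sel algebra_simps)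

end

lemma quat_scaleR_sel [simp]:
  "qre (r *\<^sub>R q) = r * qre q" "qim1 (r *\<^sub>R q) = r * qim1 q"
  "qim2 (r *\<^sub>R q) = r * qim2 q" "qim3 (r *\<^sub>R q) = r * qim3 q"
  by (simp_all add: scaleR_quat_def)

text \<open>The inner product, norm and topology are those of \<open>\<real>\<^sup>4\<close>.\<close>

instantiation quat :: real_inner
begin

definition "inner p q = qre p * qre q + qim1 p * qim1 q + qim2 p * qim2 q + qim3 p * qim3 q"
definition "norm (q :: quat) = sqrt (inner q q)"
definition "sgn (q :: quat) = q /\<^sub>R norm q"
definition "dist (p :: quat) q = norm (p - q)"
definition "(uniformity :: (quat \<times> quat) filter) = (INF e\<in>{0 <..}. principal {(p, q). dist p q < e})"
definition "open (U :: quat set) \<longleftrightarrow> (\<forall>p\<in>U. eventually (\<lambda>(p', q). p' = p \<longrightarrow> q \<in> U) uniformity)"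

instance
proof
  fix p q r :: quat and a :: real
  show "dist p q = norm (p - q)" by (rule dist_quat_def)
  show "sgn p = p /\<^sub>R norm p" by (rule sgn_quat_def)
  show "(uniformity :: (quat \<times> quat) filter) = (INF e\<in>{0 <..}. principal {(p, q). dist p q < e})"
    by (rule uniformity_quat_def)
  show "open U \<longleftrightarrow> (\<forall>p\<in>U. eventually (\<lambda>(p', q). p' = p \<longrightarrow> q \<in> U) uniformity)" for U :: "quat set"
    by (rule open_quat_def)
  show "inner p q = inner q p" by (simp add: inner_quat_def algebra_simps)
  show "inner (p + q) r = inner p r + inner q r" by (simp add: inner_quat_def algebra_simps)
  show "inner (a *\<^sub>R p) q = a * inner p q" by (simp add: inner_quat_def algebra_simps)
  show "0 \<le> inner p p" by (simp add: inner_quat_def)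
  show "inner p p = 0 \<longleftrightarrow> p = 0"
    by (auto simp: inner_quat_def quat_eq_iff add_nonneg_eq_0_iff)
  show "norm p = sqrt (inner p p)" by (rule norm_quat_def)
qed

end

lemma norm_mult_quat: "norm (p * q) = norm p * norm (q :: quat)"
proof -
  have "inner (p * q) (p * q) = inner p p * inner q q"
    unfolding inner_quat_def quat_mult_sel by (simp add: algebra_simps)
  then show ?thesis by (simp add: norm_quat_def real_sqrt_mult)
qed

lemma norm_one_quat: "norm (1 :: quat) = 1"
  by (simp add: norm_quat_def inner_quat_def)

instantiation quat :: real_normed_div_algebra
begin

definition "inverse q = Quat (qre q) (- qim1 q) (- qim2 q) (- qim3 q) /\<^sub>R inner q q"
definition "p div q = p * inverse (q :: quat)"

instance
proof
  fix p q :: quat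
  let ?c = "Quat (qre q) (- qim1 q) (- qim2 q) (- qim3 q)"
  have 1: "?c * q = inner q q *\<^sub>R 1" "q * ?c = inner q q *\<^sub>R 1"
    by (simp_all add: quat_eq_iff quat_mult_sel inner_quat_def algebra_simps)
  show "inverse q * q = 1" "q * inverse q = 1" if "q \<noteq> 0"
    using that 1 by (simp_all add: inverse_quat_def)
  show "p div q = p * inverse q" by (rule divide_quat_def)
  show "inverse (0 :: quat) = 0" by (simp add: inverse_quat_def quat_eq_iff)
  show "norm (p * q) = norm p * norm q" by (rule norm_mult_quat)
qed

end

instantiation quat :: euclidean_space
begin

definition "Basis = {Quat 1 0 0 0, Quat 0 1 0 0, Quat 0 0 1 0, Quat 0 0 0 1}"

instance
proof
  fix u v q :: quat
  show "(Basis :: quat set) \<noteq> {}" "finite (Basis :: quat set)" by (simp_all add: Basis_quat_def)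
  show "inner u v = (if u = v then 1 else 0)" if "u \<in> Basis" "v \<in> Basis"
    using that unfolding Basis_quat_def by (elim insertE emptyE; simp add: inner_quat_def)
  show "(\<forall>u\<in>Basis. inner q u = 0) \<longleftrightarrow> q = 0"
    by (simp add: Basis_quat_def inner_quat_def quat_eq_iff[of q])
qed

end

section \<open>The slice topology\<close>

definition imaginary_units :: "quat set" where
  "imaginary_units = {q. q\<^sup>2 = - 1}"

definition slice_plane :: "quat \<Rightarrow> quat set" where
  "slice_plane I = {of_real x + of_real y * I | x y. True}"

abbreviation open_in_slice_plane :: "quat \<Rightarrow> quat set \<Rightarrow> bool" where
  "open_in_slice_plane I U \<equiv> openin (top_of_set (slice_plane I)) U"

definition slice_open :: "quat set \<Rightarrow> bool" where
  "slice_open \<Omega> \<longleftrightarrow> (\<forall>I\<in>imaginary_units. open_in_slice_plane I (\<Omega> \<inter> slice_plane I))"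

definition slice_topology :: "quat topology" where
  "slice_topology = topology slice_open"

lemma istopology_slice_open: "istopology slice_open"
  unfolding istopology_def
proof (intro conjI allI impI)
  fix A B assume AB: "slice_open A" "slice_open B"
  show "slice_open (A \<inter> B)"
    unfolding slice_open_def
  proof
    fix I assume "I \<in> imaginary_units"
    with AB have "open_in_slice_plane I ((A \<inter> slice_plane I) \<inter> (B \<inter> slice_plane I))"
      unfolding slice_open_def by (simp only: openin_Int)
    moreover have "(A \<inter> slice_plane I) \<inter> (B \<inter> slice_plane I) = A \<inter> B \<inter> slice_plane I"
      by blast
    ultimately show "open_in_slice_plane I (A \<inter> B \<inter> slice_plane I)"
      by (rule back_subst)
  qed
next
  fix \<K> assume *: "\<forall>K\<in>\<K>. slice_open K"
  show "slice_open (\<Union>\<K>)"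
    unfolding slice_open_def
  proof
    fix I assume I: "I \<in> imaginary_units"
    have "open_in_slice_plane I (\<Union>K\<in>\<K>. K \<inter> slice_plane I)"
    proof (rule openin_Union)
      fix U assume "U \<in> (\<lambda>K. K \<inter> slice_plane I) ` \<K>"
      then obtain K where "K \<in> \<K>" "U = K \<inter> slice_plane I" by blast
      with * I show "open_in_slice_plane I U" unfolding slice_open_def by blast
    qed
    moreover have "(\<Union>K\<in>\<K>. K \<inter> slice_plane I) = \<Union>\<K> \<inter> slice_plane I"
      by blast
    ultimately show "open_in_slice_plane I (\<Union>\<K> \<inter> slice_plane I)"
      by (rule back_subst)
  qed
qed

lemma openin_slice_topology: "openin slice_topology \<Omega> \<longleftrightarrow> slice_open \<Omega>"
  by (simp add: slice_topology_def topology_inverse'[OF istopology_slice_open])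

section \<open>Slice regular functions\<close>

text \<open>Functions are total; only the values on \<open>U\<close> matter, as \<open>U\<close> is always taken to be open in
  \<open>slice_plane I\<close>. The functions \<open>hx\<close> and \<open>hy\<close> are the partial derivatives of
  \<open>(x, y) \<mapsto> h (x + y I)\<close>, regarded as functions of the point \<open>x + y I\<close> of \<open>U\<close>.\<close>

definition slice_holomorphic_on :: "quat \<Rightarrow> (quat \<Rightarrow> quat) \<Rightarrow> quat set \<Rightarrow> bool" where
  "slice_holomorphic_on I h U \<longleftrightarrow>
    (\<exists>hx hy. continuous_on U hx \<and> continuous_on U hy \<and>
      (\<forall>x y. of_real x + of_real y * I \<in> U \<longrightarrow>
        ((\<lambda>s. h (of_real s + of_real y * I)) has_vector_derivative
            hx (of_real x + of_real y * I)) (at x) \<and>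
        ((\<lambda>t. h (of_real x + of_real t * I)) has_vector_derivative
            hy (of_real x + of_real y * I)) (at y) \<and>
        (1/2) *\<^sub>R (hx (of_real x + of_real y * I) + I * hy (of_real x + of_real y * I)) = 0))"

definition slice_regular_on :: "(quat \<Rightarrow> quat) \<Rightarrow> quat set \<Rightarrow> bool" where
  "slice_regular_on f \<Omega> \<longleftrightarrow>
    (\<forall>I\<in>imaginary_units. slice_holomorphic_on I f (\<Omega> \<inter> slice_plane I))"

definition domain_of_slice_regularity :: "quat set \<Rightarrow> bool" where
  "domain_of_slice_regularity \<Omega> \<longleftrightarrow>
    \<not> (\<exists>\<Omega>1 \<Omega>2. slice_open \<Omega>1 \<and> slice_open \<Omega>2 \<and>
        \<Omega>1 \<noteq> {} \<and> \<Omega>1 \<subseteq> \<Omega>2 \<inter> \<Omega> \<and>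
        connectedin slice_topology \<Omega>2 \<and> \<not> \<Omega>2 \<subseteq> \<Omega> \<and>
        (\<forall>f. slice_regular_on f \<Omega> \<longrightarrow>
          (\<exists>g. slice_regular_on g \<Omega>2 \<and> (\<forall>q\<in>\<Omega>1. f q = g q))))"

definition slice_triple :: "quat \<Rightarrow> quat set \<Rightarrow> quat set \<Rightarrow> quat set \<Rightarrow> bool" where
  "slice_triple I \<Omega> U1 U2 \<longleftrightarrow>
    U1 \<noteq> {} \<and> U1 \<subseteq> U2 \<inter> (\<Omega> \<inter> slice_plane I) \<and>
    connected U2 \<and> \<not> U2 \<subseteq> \<Omega> \<inter> slice_plane I \<and>
    (\<forall>f. slice_regular_on f \<Omega> \<longrightarrow>
      (\<exists>g. slice_holomorphic_on I g U2 \<and> (\<forall>q\<in>U1. f q = g q)))"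

end

theory Submission
  imports Defs "HOL-Complex_Analysis.Complex_Analysis"
begin

text \<open>An extension of all slice regular functions across a boundary point of \<open>\<Omega>\<close> inside one slice plane is
  turned into one on a slice-open set: near a non-real point a disc of the plane is already slice-open, and
  near a real point the representation formula extends a holomorphic function from the disc to the whole
  quaternionic ball. Conversely, given \<open>\<Omega>1\<close> and \<open>\<Omega>2\<close>, let \<open>A\<close> be the set of points of \<open>\<Omega> \<inter> \<Omega>2\<close> around
  which, in some slice plane, every \<open>f\<close> agrees with each of its extensions. The identity theorem propagates
  agreement from one plane to another through real points, so \<open>A\<close> is slice-open; in the absence of triples a
  disc in \<open>\<Omega>2\<close> meeting \<open>A\<close> lies in \<open>A\<close>, so \<open>A\<close> is also relatively closed, and thus
  \<open>A = \<Omega>2\<close> would be contained in \<open>\<Omega>\<close>.\<close>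

section \<open>Complex coordinates on a slice plane\<close>

definition slice_embed :: "quat \<Rightarrow> complex \<Rightarrow> quat" where
  "slice_embed I z = of_real (Re z) + of_real (Im z) * I"

text \<open>Inner products give a map that is defined and continuous on all quaternions. Since
  \<open>1\<close> and \<open>I\<close> are orthonormal, it inverts \<open>slice_embed I\<close> on
  the plane.\<close>

definition slice_coord :: "quat \<Rightarrow> quat \<Rightarrow> complex" where
  "slice_coord I q = Complex (inner 1 q) (inner I q)"

lemma slice_plane_eq_range: "slice_plane I = range (slice_embed I)"
proof
  show "slice_plane I \<subseteq> range (slice_embed I)"
  proof
    fix q assume "q \<in> slice_plane I"
    then obtain x y where "q = of_real x + of_real y * I" by (auto simp: slice_plane_def)
    then have "q = slice_embed I (Complex x y)" by (simp add: slice_embed_def)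
    then show "q \<in> range (slice_embed I)" by blast
  qed
qed (auto simp: slice_plane_def slice_embed_def)

lemma slice_embed_in_plane [simp]: "slice_embed I z \<in> slice_plane I"
  by (simp add: slice_plane_eq_range)

lemma slice_plane_cases:
  assumes "q \<in> slice_plane I"
  obtains z where "q = slice_embed I z"
  using assms by (auto simp: slice_plane_eq_range)

lemma imaginary_units_square: "I \<in> imaginary_units \<Longrightarrow> I * I = - 1"
  by (simp add: imaginary_units_def power2_eq_square)

lemma imaginary_units_left_cancel: "I \<in> imaginary_units \<Longrightarrow> I * (I * q) = - q"
  by (simp add: imaginary_units_square flip: mult.assoc)

lemma imaginary_units_neg: "I \<in> imaginary_units \<Longrightarrow> - I \<in> imaginary_units"
  by (simp add: imaginary_units_def)

text \<open>Compare components in \<open>I * I = - 1\<close>. The imaginary ones are twice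
  \<open>qre I\<close> times those of \<open>I\<close>, so a nonzero real part would leave its own
  square equal to -1. Orthonormality of \<open>1\<close> and \<open>I\<close> is what makes
  \<open>slice_embed I\<close> an isometry.\<close>

lemma imaginary_units_inner:
  assumes "I \<in> imaginary_units"
  shows "inner 1 I = 0" "inner I I = 1" "norm I = 1"
proof -
  have sq: "I * I = - 1" by (rule imaginary_units_square[OF assms])
  have 1: "qre I * qre I - qim1 I * qim1 I - qim2 I * qim2 I - qim3 I * qim3 I = -1"
    using arg_cong[OF sq, of qre] by (simp add: quat_mult_sel)
  have 2: "qre I * qim1 I = 0" "qre I * qim2 I = 0" "qre I * qim3 I = 0"
    using arg_cong[OF sq, of qim1] arg_cong[OF sq, of qim2] arg_cong[OF sq, of qim3]
    by (simp_all add: quat_mult_sel algebra_simps)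
  have re: "qre I = 0"
  proof (rule ccontr)
    assume "qre I \<noteq> 0"
    with 2 have "qim1 I = 0" "qim2 I = 0" "qim3 I = 0" by auto
    with 1 have "qre I * qre I = -1" by simp
    moreover have "0 \<le> qre I * qre I" by simp
    ultimately show False by linarith
  qed
  show "inner 1 I = 0" by (simp add: inner_quat_def re)
  show *: "inner I I = 1" using 1 by (simp add: inner_quat_def re)
  show "norm I = 1" by (simp add: norm_eq_sqrt_inner *)
qed

lemma inner_quat_one_one [simp]: "inner (1::quat) 1 = 1"
  by (simp add: inner_quat_def)

lemma slice_embed_altdef: "slice_embed I z = Re z *\<^sub>R 1 + Im z *\<^sub>R I"
  by (simp add: slice_embed_def scaleR_conv_of_real)

lemma slice_coord_embed [simp]:
  assumes "I \<in> imaginary_units"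
  shows "slice_coord I (slice_embed I z) = z"
  using imaginary_units_inner[OF assms]
  by (simp add: slice_coord_def slice_embed_altdef inner_right_distrib inner_commute complex_eq_iff)

lemma slice_embed_coord:
  assumes "I \<in> imaginary_units" "q \<in> slice_plane I"
  shows "slice_embed I (slice_coord I q) = q"
  using assms by (auto elim!: slice_plane_cases)

lemma slice_embed_add: "slice_embed I (z + w) = slice_embed I z + slice_embed I w"
  by (simp add: slice_embed_altdef algebra_simps)

lemma slice_embed_diff: "slice_embed I (z - w) = slice_embed I z - slice_embed I w"
  by (simp add: slice_embed_altdef algebra_simps)

lemma slice_embed_of_real [simp]: "slice_embed I (of_real x) = of_real x"
  by (simp add: slice_embed_def)

lemma norm_slice_embed:
  assumes "I \<in> imaginary_units"
  shows "norm (slice_embed I z) = norm z"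
  using imaginary_units_inner[OF assms]
  by (subst norm_eq_sqrt_inner) (simp add: slice_embed_altdef inner_add_left
      inner_add_right inner_commute[of I 1] cmod_def power2_eq_square)

lemma dist_slice_embed:
  assumes "I \<in> imaginary_units"
  shows "dist (slice_embed I z) (slice_embed I w) = dist z w"
  using norm_slice_embed[OF assms, of "z - w"] by (simp add: dist_norm slice_embed_diff)

lemma continuous_on_slice_embed [continuous_intros]:
  "continuous_on A f \<Longrightarrow> continuous_on A (\<lambda>x. slice_embed I (f x))"
  unfolding slice_embed_altdef by (intro continuous_intros)

lemma continuous_on_slice_coord: "continuous_on A (slice_coord I)"
  unfolding slice_coord_def complex_eq_iff Complex_eq by (intro continuous_intros)

text \<open>The real parts agree, and the norms of the imaginary parts fix \<open>Im z\<close> up to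
  sign; cancelling a nonzero \<open>Im w\<close> identifies \<open>I\<close> with \<open>J\<close>
  or \<open>- J\<close>. The third case is a real point, which lies in every slice plane.\<close>

lemma slice_embed_eq_cases:
  assumes IJ: "I \<in> imaginary_units" "J \<in> imaginary_units"
    and eq: "slice_embed I z = slice_embed J w"
  shows "I = J \<and> z = w \<or> I = - J \<and> z = cnj w \<or> z = w \<and> Im w = 0"
proof -
  note I = imaginary_units_inner[OF IJ(1)] and J = imaginary_units_inner[OF IJ(2)]
  have re: "Re z = Re w"
    using arg_cong[OF eq, of "inner 1"] I J by (simp add: slice_embed_altdef inner_right_distrib)
  have im: "Im z *\<^sub>R I = Im w *\<^sub>R J"
    using eq re by (simp add: slice_embed_altdef)
  have "\<bar>Im z\<bar> = \<bar>Im w\<bar>"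
    using arg_cong[OF im, of norm] I J by simp
  then consider "Im z = Im w" | "Im z = - Im w" by linarith
  then show ?thesis
  proof cases
    case 1
    then show ?thesis using re im by (cases "Im w = 0") (auto simp: complex_eq_iff)
  next
    case 2
    have "Im w *\<^sub>R J = - (Im w *\<^sub>R I)" using im 2 by (metis scaleR_minus_left)
    then have "Im w *\<^sub>R (I + J) = 0" by (simp add: scaleR_add_right)
    then have "Im w = 0 \<or> I = - J" by (simp add: eq_neg_iff_add_eq_0)
    then show ?thesis using re 2 by (auto simp: complex_eq_iff)
  qed
qed

lemma slice_plane_neg: "slice_plane (- I) = slice_plane I"
proof -
  have sub: "slice_plane (- J) \<subseteq> slice_plane J" for J
  proof -
    have "slice_embed (- J) z = slice_embed J (cnj z)" for z
      by (simp add: slice_embed_def)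
    then show ?thesis unfolding slice_plane_eq_range[of "- J"] by auto
  qed
  show ?thesis using sub[of I] sub[of "- I"] by simp
qed

lemma slice_planes_meet_in_reals:
  assumes "I \<in> imaginary_units" "J \<in> imaginary_units" "q \<in> slice_plane I" "q \<in> slice_plane J"
  shows "J = I \<or> J = - I \<or> q \<in> \<real>"
proof -
  obtain z w where zw: "q = slice_embed J z" "q = slice_embed I w"
    using assms by (metis slice_plane_cases)
  with slice_embed_eq_cases[of J I z w] assms
  have "J = I \<or> J = - I \<or> Im w = 0" by auto
  moreover have "q \<in> \<real>" if "Im w = 0"
    unfolding zw(2) using that by (simp add: slice_embed_def)
  ultimately show ?thesis by blast
qed

text \<open>A purely imaginary \<open>v\<close> squares to minus its squared norm, so normalising
  the imaginary part of \<open>q\<close> gives the unit. A real \<open>q\<close> lies in every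
  plane, and \<open>Quat 0 1 0 0\<close> serves.\<close>

lemma ex_slice_plane: "\<exists>I\<in>imaginary_units. q \<in> slice_plane I"
proof -
  define v where "v = Quat 0 (qim1 q) (qim2 q) (qim3 q)"
  have q: "q = of_real (qre q) + v"
    by (simp add: v_def quat_eq_iff of_real_def)
  have vv: "v * v = - of_real (inner v v)"
    by (simp add: v_def quat_eq_iff quat_mult_sel inner_quat_def of_real_def)
  show ?thesis
  proof (cases "v = 0")
    case True
    have "Quat 0 1 0 0 \<in> imaginary_units"
      by (simp add: imaginary_units_def power2_eq_square quat_eq_iff quat_mult_sel)
    moreover have "q \<in> slice_plane (Quat 0 1 0 0)"
      using q True slice_embed_in_plane[of _ "of_real (qre q)"] by simp
    ultimately show ?thesis by blast
  next
    case False
    define I where "I = v /\<^sub>R norm v"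
    have "I * I = (inverse (norm v) * inverse (norm v)) *\<^sub>R (v * v)"
      by (simp add: I_def)
    also have "\<dots> = - of_real (inverse (norm v) * inverse (norm v) * (norm v)\<^sup>2)"
      by (simp add: vv scaleR_conv_of_real power2_norm_eq_inner)
    also have "inverse (norm v) * inverse (norm v) * (norm v)\<^sup>2 = 1"
      using False by (simp add: power2_eq_square field_simps)
    finally have "I \<in> imaginary_units"
      by (simp add: imaginary_units_def power2_eq_square)
    moreover have "q = slice_embed I (Complex (qre q) (norm v))"
      using q False by (simp add: slice_embed_altdef I_def of_real_def)
    then have "q \<in> slice_plane I" by (metis slice_embed_in_plane)
    ultimately show ?thesis by blast
  qed
qed

section \<open>Topology of a slice plane\<close>

lemma open_vimage_slice_embed:
  assumes "open_in_slice_plane I U"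
  shows "open (slice_embed I -` U)"
proof -
  obtain T where T: "open T" "U = slice_plane I \<inter> T"
    using assms by (auto simp: openin_open)
  then have "slice_embed I -` U = slice_embed I -` T" by auto
  also have "open \<dots>"
    using T(1) by (intro open_vimage continuous_intros)
  finally show ?thesis .
qed

lemma connected_vimage_slice_embed:
  assumes "I \<in> imaginary_units" "U \<subseteq> slice_plane I" "connected U"
  shows "connected (slice_embed I -` U)"
proof -
  \<comment> \<open>The preimage is rewritten as a continuous image, because connectedness passes to
    images.\<close>
  have "slice_embed I -` U = slice_coord I ` U"
    using assms(1,2) by (force simp: slice_embed_coord image_iff)
  then show ?thesis
    using connected_continuous_image[OF continuous_on_slice_coord assms(3)] by simp
qed

lemma slice_disc:
  shows "open_in_slice_plane I (ball q r \<inter> slice_plane I)"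
    and "connected (ball q r \<inter> slice_plane I)"
proof -
  show "open_in_slice_plane I (ball q r \<inter> slice_plane I)"
    by (simp add: Int_commute openin_open_Int)
  have "linear (slice_embed I)"
    by (intro linearI) (simp_all add: slice_embed_altdef algebra_simps)
  then have "convex (slice_plane I)"
    unfolding slice_plane_eq_range by (intro convex_linear_image convex_UNIV)
  then show "connected (ball q r \<inter> slice_plane I)"
    by (intro convex_connected convex_Int convex_ball)
qed

text \<open>The approximating points are \<open>q + of_real t\<close> with small real
  \<open>t\<close>: a real translation keeps a point in every slice plane that contains it. This
  lets agreement pass from one plane to another at a real point.\<close>

lemma islimpt_slice_planes:
  assumes V: "open_in_slice_plane I V" "q \<in> V" and J: "q \<in> slice_plane J" and r: "r > 0"
  shows "q islimpt V \<inter> (ball q r \<inter> slice_plane J)"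
  unfolding islimpt_approachable
proof (intro allI impI)
  fix e :: real assume e: "e > 0"
  have qI: "q \<in> slice_plane I"
    using V openin_subset by fastforce
  obtain d where d: "d > 0" "ball q d \<inter> slice_plane I \<subseteq> V"
    using V by (auto simp: openin_contains_ball)
  define t where "t = min (min d r) e / 2"
  have t: "0 < t" "t < d" "t < r" "t < e" using d r e by (auto simp: t_def)
  define y where "y = q + of_real t"
  have plane: "y \<in> slice_plane K" if "q \<in> slice_plane K" for K
    using that by (elim slice_plane_cases) (metis slice_embed_add slice_embed_in_plane slice_embed_of_real y_def)
  have "dist y q = t" "dist q y = t" using t by (simp_all add: y_def dist_norm)
  then show "\<exists>x'\<in>V \<inter> (ball q r \<inter> slice_plane J). x' \<noteq> q \<and> dist x' q < e"
    using t d plane[OF qI] plane[OF J] by (intro bexI[of _ y]) auto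
qed

section \<open>Holomorphy in a slice plane\<close>

lemma slice_holomorphic_on_subset:
  assumes "slice_holomorphic_on I h U" "V \<subseteq> U"
  shows "slice_holomorphic_on I h V"
  using assms unfolding slice_holomorphic_on_def
  by (meson continuous_on_subset subsetD)

text \<open>Trades the two real variables for one complex variable. The partial derivatives are
  composed with \<open>slice_embed I\<close> in one direction and with \<open>slice_coord I\<close>
  in the other.\<close>

lemma slice_holomorphic_on_coord:
  assumes I: "I \<in> imaginary_units" and U: "U \<subseteq> slice_plane I"
  shows "slice_holomorphic_on I h U \<longleftrightarrow>
    (\<exists>hx hy. continuous_on (slice_embed I -` U) hx \<and> continuous_on (slice_embed I -` U) hy \<and>
      (\<forall>z. slice_embed I z \<in> U \<longrightarrow>
        ((\<lambda>s. h (slice_embed I (Complex s (Im z)))) has_vector_derivative hx z) (at (Re z)) \<and>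
        ((\<lambda>t. h (slice_embed I (Complex (Re z) t))) has_vector_derivative hy z) (at (Im z)) \<and>
        hx z + I * hy z = 0))"
    (is "_ \<longleftrightarrow> (\<exists>hx hy. ?P hx hy)")
proof
  assume "slice_holomorphic_on I h U"
  then obtain hx hy where h: "continuous_on U hx" "continuous_on U hy"
    "\<And>x y. of_real x + of_real y * I \<in> U \<Longrightarrow>
        ((\<lambda>s. h (of_real s + of_real y * I)) has_vector_derivative
            hx (of_real x + of_real y * I)) (at x) \<and>
        ((\<lambda>t. h (of_real x + of_real t * I)) has_vector_derivative
            hy (of_real x + of_real y * I)) (at y) \<and>
        (1/2) *\<^sub>R (hx (of_real x + of_real y * I) + I * hy (of_real x + of_real y * I)) = 0"
    unfolding slice_holomorphic_on_def by blast
  have "?P (\<lambda>z. hx (slice_embed I z)) (\<lambda>z. hy (slice_embed I z))"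
  proof (intro conjI allI impI)
    show "continuous_on (slice_embed I -` U) (\<lambda>z. hx (slice_embed I z))"
      by (rule continuous_on_compose2[OF h(1)]) (auto intro!: continuous_intros)
    show "continuous_on (slice_embed I -` U) (\<lambda>z. hy (slice_embed I z))"
      by (rule continuous_on_compose2[OF h(2)]) (auto intro!: continuous_intros)
  qed (use h(3)[of "Re z" "Im z" for z] in \<open>auto simp: slice_embed_def\<close>)
  then show "\<exists>hx hy. ?P hx hy" by blast
next
  assume "\<exists>hx hy. ?P hx hy"
  then obtain hx hy where h: "?P hx hy" by blast
  have sub: "slice_coord I ` U \<subseteq> slice_embed I -` U"
    using I U by (auto simp: slice_embed_coord)
  show "slice_holomorphic_on I h U"
    unfolding slice_holomorphic_on_def
  proof (intro exI conjI allI impI)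
    show "continuous_on U (\<lambda>q. hx (slice_coord I q))" "continuous_on U (\<lambda>q. hy (slice_coord I q))"
      using h sub by (auto intro: continuous_on_compose2 continuous_on_slice_coord)
    fix x y :: real assume xy: "of_real x + of_real y * I \<in> U"
    have eq: "of_real x + of_real y * I = slice_embed I (Complex x y)"
      by (simp add: slice_embed_def)
    have [simp]: "slice_coord I (of_real x + of_real y * I) = Complex x y"
      using I by (simp add: eq)
    note d = h[THEN conjunct2, THEN conjunct2, rule_format, of "Complex x y"]
    from d xy show "((\<lambda>s. h (of_real s + of_real y * I)) has_vector_derivative
          hx (slice_coord I (of_real x + of_real y * I))) (at x)"
      "((\<lambda>t. h (of_real x + of_real t * I)) has_vector_derivative
          hy (slice_coord I (of_real x + of_real y * I))) (at y)"
      "(1/2) *\<^sub>R (hx (slice_coord I (of_real x + of_real y * I)) +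
        I * hy (slice_coord I (of_real x + of_real y * I))) = 0"
      by (simp_all add: slice_embed_def)
  qed
qed

section \<open>Cauchy-Riemann equations and the identity theorem\<close>

text \<open>Continuity of \<open>fy\<close> combines the two partial derivatives into a total real
  derivative, and the Cauchy-Riemann equation makes that derivative multiplication by
  \<open>fx z\<close>.\<close>

lemma holomorphic_on_Cauchy_Riemann:
  fixes f :: "complex \<Rightarrow> complex"
  assumes "open S" and cont: "continuous_on S fy"
    and fx: "\<And>z. z \<in> S \<Longrightarrow> ((\<lambda>s. f (Complex s (Im z))) has_vector_derivative fx z) (at (Re z))"
    and fy: "\<And>z. z \<in> S \<Longrightarrow> ((\<lambda>t. f (Complex (Re z) t)) has_vector_derivative fy z) (at (Im z))"
    and CR: "\<And>z. z \<in> S \<Longrightarrow> fy z = \<i> * fx z"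
  shows "f holomorphic_on S"
proof -
  have "(f has_field_derivative fx z) (at z)" if z: "z \<in> S" for z
  proof -
    define T where "T = (\<lambda>(x, y). Complex x y) -` S"
    have T: "open T"
      unfolding T_def case_prod_unfold using \<open>open S\<close>
      by (intro open_vimage) (auto intro!: continuous_intros simp: Complex_eq)
    have "(Re z, Im z) \<in> T" using z by (simp add: T_def)
    then obtain X Y where XY: "open X" "open Y" "(Re z, Im z) \<in> X \<times> Y" "X \<times> Y \<subseteq> T"
      using T by (elim open_prod_elim) blast
    then obtain d where d: "d > 0" "ball (Im z) d \<subseteq> Y"
      by (auto simp: open_contains_ball)
    \<comment> \<open>The second factor is shrunk to a ball because
      \<open>has_derivative_partialsI\<close> asks for a convex set there.\<close>
    define Y' where "Y' = ball (Im z) d"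
    have Y': "X \<times> Y' \<subseteq> T" "open (X \<times> Y')" "(Re z, Im z) \<in> X \<times> Y'"
      using XY d by (auto simp: Y'_def intro: open_Times)
    have in_S: "Complex x y \<in> S" if "x \<in> X" "y \<in> Y'" for x y
      using Y' that by (auto simp: T_def)
    have "((\<lambda>(x, y). f (Complex x y)) has_derivative
      (\<lambda>(tx, ty). tx *\<^sub>R fx z + blinfun_apply (blinfun_scaleR_left (fy (Complex (Re z) (Im z)))) ty))
        (at (Re z, Im z) within X \<times> Y')"
    proof (rule has_derivative_partialsI)
      show "((\<lambda>x. f (Complex x (Im z))) has_derivative (\<lambda>tx. tx *\<^sub>R fx z)) (at (Re z) within X)"
        using fx[OF z] by (simp add: has_vector_derivative_def has_derivative_at_withinI)
      show "((\<lambda>y. f (Complex x y)) has_derivative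
          blinfun_apply (blinfun_scaleR_left (fy (Complex x y)))) (at y within Y')"
        if "x \<in> X" "y \<in> Y'" for x y
        using fy[OF in_S[OF that]]
        by (simp add: has_vector_derivative_def has_derivative_at_withinI)
      have "continuous_on (X \<times> Y') (\<lambda>p. Complex (fst p) (snd p))"
        unfolding Complex_eq by (intro continuous_intros)
      then have "continuous_on (X \<times> Y') (\<lambda>p. fy (Complex (fst p) (snd p)))"
        by (rule continuous_on_compose2[OF cont]) (auto intro!: in_S)
      then have "continuous_on (X \<times> Y') (\<lambda>(x, y). blinfun_scaleR_left (fy (Complex x y)))"
        unfolding case_prod_unfold by (intro continuous_intros)
      then show "continuous (at (Re z, Im z) within X \<times> Y')
          (\<lambda>(x, y). blinfun_scaleR_left (fy (Complex x y)))"
        using Y'(3) by (simp add: continuous_on_eq_continuous_within)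
    qed (use d in \<open>auto simp: Y'_def\<close>)
    then have D: "((\<lambda>(x, y). f (Complex x y)) has_derivative
        (\<lambda>(tx, ty). tx *\<^sub>R fx z + ty *\<^sub>R fy z)) (at (Re z, Im z))"
      using Y' by (simp add: at_within_open[of _ "X \<times> Y'"])
    have "((\<lambda>z. (Re z, Im z)) has_derivative (\<lambda>t. (Re t, Im t))) (at z)"
      by (auto intro!: derivative_eq_intros)
    from has_derivative_compose[OF this D]
    have "(f has_derivative (\<lambda>t. Re t *\<^sub>R fx z + Im t *\<^sub>R fy z)) (at z)"
      by simp
    moreover have "(\<lambda>t. Re t *\<^sub>R fx z + Im t *\<^sub>R fy z) = (*) (fx z)"
      using CR[OF z] by (auto simp: complex_eq_iff algebra_simps)
    ultimately show ?thesis by (simp add: has_field_derivative_def)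
  qed
  then show ?thesis
    using \<open>open S\<close> by (auto simp: holomorphic_on_open)
qed

text \<open>As \<open>a\<close> ranges over \<open>\<real>\<^sup>4\<close>, these are the \<open>\<complex>\<close>-linear functionals on the quaternions, regarded as a
  left vector space over \<open>slice_plane I\<close>. They reduce the identity theorem to complex-valued functions.\<close>

definition slice_functional :: "quat \<Rightarrow> quat \<Rightarrow> quat \<Rightarrow> complex" where
  "slice_functional I a q = Complex (inner q a) (- inner (I * q) a)"

lemma bounded_linear_slice_functional: "bounded_linear (slice_functional I a)"
proof -
  have "linear (slice_functional I a)"
    by (intro linearI)
      (simp_all add: slice_functional_def complex_eq_iff inner_add_left distrib_left)
  then show ?thesis by (simp add: linear_conv_bounded_linear)
qed

lemma slice_functional_mult:
  assumes "I \<in> imaginary_units"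
  shows "slice_functional I a (I * q) = \<i> * slice_functional I a q"
  by (simp add: slice_functional_def imaginary_units_left_cancel[OF assms] complex_eq_iff)

lemma holomorphic_slice_functional:
  assumes I: "I \<in> imaginary_units" and U: "open_in_slice_plane I U"
    and h: "slice_holomorphic_on I h U"
  shows "(\<lambda>z. slice_functional I a (h (slice_embed I z))) holomorphic_on slice_embed I -` U"
proof -
  let ?F = "slice_functional I a"
  have "U \<subseteq> slice_plane I" using U openin_subset by fastforce
  with h obtain hx hy where c: "continuous_on (slice_embed I -` U) hx" "continuous_on (slice_embed I -` U) hy"
    and d: "\<And>z. slice_embed I z \<in> U \<Longrightarrow>
        ((\<lambda>s. h (slice_embed I (Complex s (Im z)))) has_vector_derivative hx z) (at (Re z)) \<and>
        ((\<lambda>t. h (slice_embed I (Complex (Re z) t))) has_vector_derivative hy z) (at (Im z)) \<and>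
        hx z + I * hy z = 0"
    by (auto simp: slice_holomorphic_on_coord[OF I])
  note bl = bounded_linear_slice_functional[of I a]
  show ?thesis
  proof (rule holomorphic_on_Cauchy_Riemann)
    show "open (slice_embed I -` U)" by (rule open_vimage_slice_embed[OF U])
    show "continuous_on (slice_embed I -` U) (\<lambda>z. ?F (hy z))"
      by (rule bounded_linear.continuous_on[OF bl c(2)])
    fix z assume "z \<in> slice_embed I -` U"
    then have z: "slice_embed I z \<in> U" by simp
    show "((\<lambda>s. ?F (h (slice_embed I (Complex s (Im z))))) has_vector_derivative ?F (hx z)) (at (Re z))"
      "((\<lambda>t. ?F (h (slice_embed I (Complex (Re z) t)))) has_vector_derivative ?F (hy z)) (at (Im z))"
      using d[OF z] by (auto intro: bounded_linear.has_vector_derivative[OF bl])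
    \<comment> \<open>Multiplying by \<open>I\<close> solves the Cauchy-Riemann equation for
      \<open>hy z\<close>.\<close>
    have "I * (hx z + I * hy z) = 0" using d[OF z] by simp
    then have "hy z = I * hx z" by (simp add: distrib_left imaginary_units_left_cancel[OF I])
    then show "?F (hy z) = \<i> * ?F (hx z)" by (simp add: slice_functional_mult[OF I])
  qed
qed

text \<open>Quaternions are equal once their inner products with every \<open>a\<close> are, and
  these are the real parts of \<open>slice_functional I a\<close>. So the classical identity theorem
  is applied to one complex function for each \<open>a\<close>. The form with a limit point serves
  changes of plane, where agreement may be known only along the real axis.\<close>

lemma slice_identity:
  assumes I: "I \<in> imaginary_units" and U: "open_in_slice_plane I U" "connected U"
    and f: "slice_holomorphic_on I f U" and g: "slice_holomorphic_on I g U"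
    and V: "V \<subseteq> U" "\<xi> \<in> U" "\<xi> islimpt V" "\<And>v. v \<in> V \<Longrightarrow> f v = g v"
    and q: "q \<in> U"
  shows "f q = g q"
proof (rule vector_eq_rdot[THEN iffD1, rule_format])
  fix a
  have sub: "U \<subseteq> slice_plane I" using U openin_subset by fastforce
  let ?h = "\<lambda>z. slice_functional I a (f (slice_embed I z)) - slice_functional I a (g (slice_embed I z))"
  obtain x where x: "\<xi> = slice_embed I x" using V sub by (meson slice_plane_cases subsetD)
  obtain z where z: "q = slice_embed I z" using q sub by (meson slice_plane_cases subsetD)
  have "x islimpt slice_embed I -` V"
    unfolding islimpt_approachable
  proof (intro allI impI)
    fix e :: real assume "e > 0"
    then obtain v where v: "v \<in> V" "v \<noteq> \<xi>" "dist v \<xi> < e"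
      using V(3) unfolding islimpt_approachable by blast
    then obtain w where "v = slice_embed I w" using V sub by (meson slice_plane_cases subsetD)
    with v x show "\<exists>w\<in>slice_embed I -` V. w \<noteq> x \<and> dist w x < e"
      by (intro bexI[of _ w]) (auto simp: dist_slice_embed[OF I])
  qed
  then have "?h z = 0"
    using V x z q
    by (intro analytic_continuation[of ?h "slice_embed I -` U" "slice_embed I -` V" x z])
      (auto intro!: holomorphic_intros holomorphic_slice_functional[OF I U(1)] f g
        open_vimage_slice_embed U connected_vimage_slice_embed I sub)
  then show "inner (f q) a = inner (g q) a"
    by (simp add: z slice_functional_def complex_eq_iff)
qed

text \<open>Passing to \<open>- I\<close> conjugates the complex coordinate. The sign that the chain
  rule puts on \<open>hy\<close> cancels against the sign of \<open>- I\<close>.\<close>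

lemma slice_holomorphic_on_neg:
  assumes I: "I \<in> imaginary_units" and U: "U \<subseteq> slice_plane I" and h: "slice_holomorphic_on I h U"
  shows "slice_holomorphic_on (- I) h U"
proof -
  from h obtain hx hy where c: "continuous_on (slice_embed I -` U) hx" "continuous_on (slice_embed I -` U) hy"
    and d: "\<And>z. slice_embed I z \<in> U \<Longrightarrow>
        ((\<lambda>s. h (slice_embed I (Complex s (Im z)))) has_vector_derivative hx z) (at (Re z)) \<and>
        ((\<lambda>t. h (slice_embed I (Complex (Re z) t))) has_vector_derivative hy z) (at (Im z)) \<and>
        hx z + I * hy z = 0"
    by (auto simp: slice_holomorphic_on_coord[OF I U])
  have neg: "slice_embed (- I) z = slice_embed I (cnj z)" for z
    by (simp add: slice_embed_def)
  have U': "U \<subseteq> slice_plane (- I)" using U by (simp add: slice_plane_neg)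
  show ?thesis
    unfolding slice_holomorphic_on_coord[OF imaginary_units_neg[OF I] U']
  proof (intro exI conjI allI impI)
    show "continuous_on (slice_embed (- I) -` U) (\<lambda>z. hx (cnj z))"
      by (rule continuous_on_compose2[OF c(1)]) (auto intro!: continuous_intros simp: neg)
    show "continuous_on (slice_embed (- I) -` U) (\<lambda>z. - hy (cnj z))"
      by (rule continuous_on_minus, rule continuous_on_compose2[OF c(2)])
        (auto intro!: continuous_intros simp: neg)
    fix z assume "slice_embed (- I) z \<in> U"
    then have z: "slice_embed I (cnj z) \<in> U" by (simp add: neg)
    have cnj: "cnj (Complex a b) = Complex a (- b)" for a b by (simp add: complex_eq_iff)
    show "((\<lambda>s. h (slice_embed (- I) (Complex s (Im z)))) has_vector_derivative hx (cnj z)) (at (Re z))"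
      using d[OF z] by (simp add: neg cnj)
    have "(uminus has_vector_derivative (- 1)) (at (Im z))"
      by (auto intro!: derivative_eq_intros)
    from vector_diff_chain_at[OF this, of "\<lambda>t. h (slice_embed I (Complex (Re z) t))" "hy (cnj z)"]
    show "((\<lambda>t. h (slice_embed (- I) (Complex (Re z) t))) has_vector_derivative - hy (cnj z)) (at (Im z))"
      using d[OF z] by (simp add: neg cnj o_def)
    show "hx (cnj z) + - I * - hy (cnj z) = 0"
      using d[OF z] by simp
  qed
qed

section \<open>Extension from a slice plane\<close>

text \<open>The representation formula for slice regular functions: the value at \<open>x + y J\<close> is a combination of
  the values at \<open>x + y I\<close> and \<open>x - y I\<close>.\<close>

definition slice_represent :: "quat \<Rightarrow> (quat \<Rightarrow> quat) \<Rightarrow> quat \<Rightarrow> complex \<Rightarrow> quat" where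
  "slice_represent I h J z =
    (1/2) *\<^sub>R (1 - J * I) * h (slice_embed I z) + (1/2) *\<^sub>R (1 + J * I) * h (slice_embed I (cnj z))"

text \<open>A quaternion has coordinates \<open>(J, z)\<close> as well as
  \<open>(- J, cnj z)\<close>, and a real one has coordinates in every plane. One pair is chosen;
  \<open>slice_represent_cong\<close> makes the value independent of the choice.\<close>

definition slice_extension :: "quat \<Rightarrow> (quat \<Rightarrow> quat) \<Rightarrow> quat \<Rightarrow> quat" where
  "slice_extension I h q =
    (let (J, z) = SOME (J, z). J \<in> imaginary_units \<and> q = slice_embed J z in slice_represent I h J z)"

text \<open>Passing from \<open>(J, z)\<close> to \<open>(- J, cnj z)\<close> swaps the two
  summands. At a real point both values of \<open>h\<close> coincide and the two coefficients add up
  to 1 for every \<open>J\<close>.\<close>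

lemma slice_represent_cong:
  assumes "J \<in> imaginary_units" "K \<in> imaginary_units" "slice_embed J z = slice_embed K w"
  shows "slice_represent I h J z = slice_represent I h K w"
  using slice_embed_eq_cases[OF assms]
proof (elim disjE conjE)
  assume *: "z = w" "Im w = 0"
  then have "cnj w = w" by (simp add: complex_eq_iff)
  moreover have "(1/2) *\<^sub>R (1 - L) * q + (1/2) *\<^sub>R (1 + L) * q = q" for L q :: quat
  proof -
    have "(1/2) *\<^sub>R (1 - L) * q + (1/2) *\<^sub>R (1 + L) * q = (1/2 + 1/2) *\<^sub>R q"
      unfolding scaleR_add_left by (simp add: algebra_simps)
    then show ?thesis by simp
  qed
  ultimately show ?thesis using * by (simp add: slice_represent_def)
qed (simp_all add: slice_represent_def add.commute)

lemma slice_extension_embed: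
  assumes "J \<in> imaginary_units"
  shows "slice_extension I h (slice_embed J z) = slice_represent I h J z"
proof -
  let ?P = "\<lambda>(K, w). K \<in> imaginary_units \<and> slice_embed J z = slice_embed K w"
  obtain K w where Kw: "(SOME p. ?P p) = (K, w)" by fastforce
  have "?P (J, z)" using assms by simp
  then have "?P (SOME p. ?P p)" by (rule someI[of ?P])
  then have "slice_represent I h J z = slice_represent I h K w"
    unfolding Kw using slice_represent_cong[OF assms] by auto
  then show ?thesis by (simp add: slice_extension_def Kw)
qed

lemma slice_extension_eq:
  assumes "I \<in> imaginary_units" "q \<in> slice_plane I"
  shows "slice_extension I h q = h q"
proof -
  obtain z where z: "q = slice_embed I z" using assms(2) by (rule slice_plane_cases)
  have "(1/2) *\<^sub>R (1 - I * I) = 1"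
    using scaleR_2[of "1::quat"] by (simp add: imaginary_units_square[OF assms(1)] quat_eq_iff)
  then show ?thesis
    by (simp add: z slice_extension_embed assms slice_represent_def imaginary_units_square)
qed

text \<open>Because the centre is real, every slice of the ball is the same complex disc, stable
  under conjugation, so the formula makes sense on all of it. Constant left factors \<open>P\<close>
  and \<open>Q\<close> commute with differentiation.\<close>

lemma slice_regular_extension:
  assumes I: "I \<in> imaginary_units"
    and h: "slice_holomorphic_on I h (ball (of_real c) r \<inter> slice_plane I)"
  shows "slice_regular_on (slice_extension I h) (ball (of_real c) r)"
  unfolding slice_regular_on_def
proof
  fix J assume J: "J \<in> imaginary_units"
  let ?S = "ball (complex_of_real c) r"
  have in_ball: "slice_embed K z \<in> ball (of_real c) r \<inter> slice_plane K \<longleftrightarrow> z \<in> ?S"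
    if "K \<in> imaginary_units" for K z
    using dist_slice_embed[OF that, of "of_real c" z] by simp
  then have vimage: "slice_embed K -` (ball (of_real c) r \<inter> slice_plane K) = ?S"
    if "K \<in> imaginary_units" for K
    using that by blast
  from h obtain hx hy where c: "continuous_on ?S hx" "continuous_on ?S hy"
    and d: "\<And>z. z \<in> ?S \<Longrightarrow>
        ((\<lambda>s. h (slice_embed I (Complex s (Im z)))) has_vector_derivative hx z) (at (Re z)) \<and>
        ((\<lambda>t. h (slice_embed I (Complex (Re z) t))) has_vector_derivative hy z) (at (Im z)) \<and>
        hx z + I * hy z = 0"
    unfolding slice_holomorphic_on_coord[OF I Int_lower2] in_ball[OF I] vimage[OF I] by blast
  have cnj_S: "cnj z \<in> ?S" if "z \<in> ?S" for z
    using that complex_mod_cnj[of "of_real c - z"] by (simp add: dist_norm del: complex_mod_cnj)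
  define P where "P = (1/2) *\<^sub>R (1 - J * I)"
  define Q where "Q = (1/2) *\<^sub>R (1 + J * I)"
  have JJII: "J * (J * (I * (I * q))) = q" for q
    by (simp add: imaginary_units_left_cancel[OF I] imaginary_units_left_cancel[OF J])
  \<comment> \<open>Equivalently, \<open>P * I = J * P\<close> and \<open>Q * I = - (J * Q)\<close>.
    Thus \<open>P\<close> carries the Cauchy-Riemann equation for \<open>I\<close> to that for
    \<open>J\<close>, and so does \<open>Q\<close> after the sign change caused by
    conjugation.\<close>
  have JPI: "J * (P * (I * q)) = - (P * q)" and JQI: "J * (Q * (I * q)) = Q * q" for q
    unfolding P_def Q_def using JJII[of q]
    by (simp_all add: algebra_simps imaginary_units_left_cancel[OF I] imaginary_units_left_cancel[OF J])
  show "slice_holomorphic_on J (slice_extension I h) (ball (of_real c) r \<inter> slice_plane J)"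
    unfolding slice_holomorphic_on_coord[OF J Int_lower2] in_ball[OF J] vimage[OF J]
      slice_extension_embed[OF J] slice_represent_def P_def[symmetric] Q_def[symmetric]
  proof (intro exI conjI allI impI)
    show "continuous_on ?S (\<lambda>z. P * hx z + Q * hx (cnj z))"
      by (intro continuous_intros c continuous_on_compose2[OF c(1)]) (use cnj_S in auto)
    show "continuous_on ?S (\<lambda>z. P * hy z + Q * - hy (cnj z))"
      by (intro continuous_intros c continuous_on_compose2[OF c(2)]) (use cnj_S in auto)
    fix z assume z: "z \<in> ?S"
    have cnj: "cnj (Complex a b) = Complex a (- b)" for a b by (simp add: complex_eq_iff)
    note dz = d[OF z] and dz' = d[OF cnj_S[OF z]]
    show "((\<lambda>s. P * h (slice_embed I (Complex s (Im z))) + Q * h (slice_embed I (cnj (Complex s (Im z)))))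
        has_vector_derivative P * hx z + Q * hx (cnj z)) (at (Re z))"
      using dz dz' by (intro has_vector_derivative_add has_vector_derivative_mult_right) (simp_all add: cnj)
    have "(uminus has_vector_derivative (- 1)) (at (Im z))"
      by (auto intro!: derivative_eq_intros)
    from vector_diff_chain_at[OF this, of "\<lambda>t. h (slice_embed I (Complex (Re z) t))" "hy (cnj z)"]
    have "((\<lambda>t. h (slice_embed I (cnj (Complex (Re z) t)))) has_vector_derivative - hy (cnj z)) (at (Im z))"
      using dz' by (simp add: cnj o_def)
    then show "((\<lambda>t. P * h (slice_embed I (Complex (Re z) t)) + Q * h (slice_embed I (cnj (Complex (Re z) t))))
        has_vector_derivative P * hy z + Q * - hy (cnj z)) (at (Im z))"
      using dz by (intro has_vector_derivative_add has_vector_derivative_mult_right) simp_all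
    have hy: "hy w = I * hx w" if "hx w + I * hy w = 0" for w
    proof -
      have "I * (hx w + I * hy w) = 0" using that by simp
      then show ?thesis by (simp add: distrib_left imaginary_units_left_cancel[OF I])
    qed
    then have "hy z = I * hx z" "hy (cnj z) = I * hx (cnj z)" using dz dz' by blast+
    then show "P * hx z + Q * hx (cnj z) + J * (P * hy z + Q * - hy (cnj z)) = 0"
      by (simp add: distrib_left right_diff_distrib JPI JQI)
  qed
qed

section \<open>The slice topology\<close>

lemma slice_open_openin: "slice_open W \<Longrightarrow> I \<in> imaginary_units \<Longrightarrow> open_in_slice_plane I (W \<inter> slice_plane I)"
  by (simp add: slice_open_def)

lemma slice_open_open: "open W \<Longrightarrow> slice_open W"
  by (simp add: slice_open_def openin_open_Int Int_commute[of W])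

lemma inner_Reals:
  assumes "I \<in> imaginary_units" "q \<in> slice_plane I"
  shows "q \<in> \<real> \<longleftrightarrow> inner I q = 0"
proof -
  obtain z where z: "q = slice_embed I z" using assms(2) by (rule slice_plane_cases)
  have im: "inner I q = Im z"
    using slice_coord_embed[OF assms(1), of z] by (simp add: slice_coord_def complex_eq_iff z)
  show ?thesis
  proof
    assume "q \<in> \<real>"
    then show "inner I q = 0"
      using imaginary_units_inner[OF assms(1)] by (auto simp: Reals_def of_real_def inner_commute)
  next
    assume "inner I q = 0"
    then show "q \<in> \<real>" using im by (simp add: z slice_embed_def)
  qed
qed

section \<open>Sets away from the real axis\<close>

text \<open>Within the plane the reals are the zero set of the continuous coordinate
  \<open>inner I\<close>, hence closed. They have empty interior, since a small shift along
  \<open>I\<close> leaves them.\<close>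

lemma open_in_slice_plane_minus_Reals:
  assumes I: "I \<in> imaginary_units" and U: "open_in_slice_plane I U"
  shows "open_in_slice_plane I (U - \<real>)" and "U \<noteq> {} \<Longrightarrow> U - \<real> \<noteq> {}"
proof -
  have sub: "U \<subseteq> slice_plane I" using U openin_subset by fastforce
  have "open {q. inner I q \<noteq> 0}" by (intro open_Collect_neq continuous_intros)
  moreover have "U - \<real> = U \<inter> {q. inner I q \<noteq> 0}"
    using sub inner_Reals[OF I] by blast
  ultimately show "open_in_slice_plane I (U - \<real>)"
    using U by (simp add: openin_Int_open)
  show "U - \<real> \<noteq> {}" if "U \<noteq> {}"
  proof
    assume "U - \<real> = {}"
    then have real: "Im z = 0" if "slice_embed I z \<in> U" for z
      using that inner_Reals[OF I slice_embed_in_plane, of z] slice_coord_embed[OF I, of z]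
      by (auto simp: slice_coord_def complex_eq_iff)
    obtain z where z: "slice_embed I z \<in> U"
      using \<open>U \<noteq> {}\<close> sub by (metis all_not_in_conv slice_plane_cases subsetD)
    then obtain d where d: "d > 0" "ball z d \<subseteq> slice_embed I -` U"
      using open_vimage_slice_embed[OF U] unfolding open_contains_ball by blast
    have "z + of_real (d/2) * \<i> \<in> ball z d" using d(1) by (simp add: dist_norm norm_mult)
    with d have "slice_embed I (z + of_real (d/2) * \<i>) \<in> U" by blast
    from real[OF this] real[OF z] d(1) show False by simp
  qed
qed

text \<open>Distinct slice planes share only real points, so a set off the real axis is seen only
  from \<open>I\<close> and \<open>- I\<close>, whose planes coincide.\<close>

lemma off_Reals_Int_slice_plane:
  assumes "I \<in> imaginary_units" "J \<in> imaginary_units" "U \<subseteq> slice_plane I" "U \<inter> \<real> = {}"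
  shows "(J = I \<or> J = - I) \<and> U \<inter> slice_plane J = U \<or> U \<inter> slice_plane J = {}"
proof (cases "J = I \<or> J = - I")
  case True
  then have "slice_plane J = slice_plane I" by (auto simp: slice_plane_neg)
  with True assms show ?thesis by blast
next
  case False
  with slice_planes_meet_in_reals[OF assms(1,2)] assms(3,4) show ?thesis by blast
qed

lemma slice_open_off_Reals:
  assumes I: "I \<in> imaginary_units" and U: "open_in_slice_plane I U" "U \<inter> \<real> = {}"
  shows "slice_open U"
  unfolding slice_open_def
proof
  fix J assume J: "J \<in> imaginary_units"
  have "U \<subseteq> slice_plane I" using U openin_subset by fastforce
  from off_Reals_Int_slice_plane[OF I J this U(2)] U(1)
  show "open_in_slice_plane J (U \<inter> slice_plane J)"
    by (auto simp: slice_plane_neg)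
qed

lemma slice_regular_off_Reals:
  assumes I: "I \<in> imaginary_units" and U: "U \<subseteq> slice_plane I" "U \<inter> \<real> = {}"
    and h: "slice_holomorphic_on I h U"
  shows "slice_regular_on h U"
  unfolding slice_regular_on_def
proof
  fix J assume J: "J \<in> imaginary_units"
  have "slice_holomorphic_on J h {}" by (simp add: slice_holomorphic_on_def)
  with off_Reals_Int_slice_plane[OF I J U] h slice_holomorphic_on_neg[OF I U(1) h]
  show "slice_holomorphic_on J h (U \<inter> slice_plane J)" by auto
qed

section \<open>Connectedness in the slice topology\<close>

text \<open>By the definition of slice-open sets each slice plane includes continuously into the
  slice topology, and continuous maps preserve connectedness.\<close>

lemma connectedin_slice_topology:
  assumes "I \<in> imaginary_units" "U \<subseteq> slice_plane I" "connected U"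
  shows "connectedin slice_topology U"
proof -
  have top: "topspace slice_topology = UNIV"
    using openin_subset[of slice_topology UNIV] by (auto simp: openin_slice_topology slice_open_open)
  have "continuous_map (top_of_set (slice_plane I)) slice_topology id"
    using assms(1) slice_open_openin
    by (auto simp: continuous_map_def top openin_slice_topology Int_def conj_commute)
  moreover have "connectedin (top_of_set (slice_plane I)) U"
    using assms by (simp add: connectedin_subtopology)
  ultimately show ?thesis
    using connectedin_continuous_map_image[of _ slice_topology id U] by simp
qed

text \<open>The ball is the union of its slices, which are connected and share the real
  centre.\<close>

lemma connectedin_slice_topology_ball:
  "connectedin slice_topology (ball (of_real c) r)"
proof -
  have "connectedin slice_topology (\<Union>I\<in>imaginary_units. ball (of_real c) r \<inter> slice_plane I)" if "r > 0"
  proof (rule connectedin_Union)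
    have "(of_real c :: quat) \<in> slice_plane I" for I
      using slice_embed_in_plane[of I "of_real c"] by simp
    with that have "of_real c \<in> (\<Inter>I\<in>imaginary_units. ball (of_real c) r \<inter> slice_plane I)"
      by simp
    then show "(\<Inter>I\<in>imaginary_units. ball (of_real c :: quat) r \<inter> slice_plane I) \<noteq> {}" by blast
  qed (auto intro: connectedin_slice_topology slice_disc(2))
  moreover have "(\<Union>I\<in>imaginary_units. ball (of_real c) r \<inter> slice_plane I) = ball (of_real c) r"
    using ex_slice_plane by blast
  moreover have "ball (of_real c :: quat) r = {}" if "\<not> r > 0" using that by simp
  ultimately show ?thesis by (metis connectedin_empty)
qed

text \<open>Off the real axis a small disc of a slice plane is itself slice-open; around a real point it has to be
  thickened to a quaternionic ball.\<close>

lemma slice_disc_thicken: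
  assumes I: "I \<in> imaginary_units" and U: "open_in_slice_plane I U" "p \<in> U"
  obtains r W where "r > 0" "ball p r \<inter> slice_plane I \<subseteq> U \<inter> W"
    "slice_open W" "connectedin slice_topology W"
    "\<And>h. slice_holomorphic_on I h (ball p r \<inter> slice_plane I) \<Longrightarrow>
      \<exists>F. slice_regular_on F W \<and> (\<forall>q\<in>ball p r \<inter> slice_plane I. F q = h q)"
proof (cases "p \<in> \<real>")
  case True
  then obtain c where c: "p = of_real c" by (auto elim: Reals_cases)
  obtain r where r: "r > 0" "ball p r \<inter> slice_plane I \<subseteq> U"
    using U by (auto simp: openin_contains_ball)
  show ?thesis
  proof (rule that[OF r(1)])
    show "ball p r \<inter> slice_plane I \<subseteq> U \<inter> ball p r" using r by blast
    show "slice_open (ball p r)" by (simp add: slice_open_open)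
    show "connectedin slice_topology (ball p r)" by (simp add: c connectedin_slice_topology_ball)
    fix h assume "slice_holomorphic_on I h (ball p r \<inter> slice_plane I)"
    then have "slice_regular_on (slice_extension I h) (ball p r)"
      unfolding c by (rule slice_regular_extension[OF I])
    then show "\<exists>F. slice_regular_on F (ball p r) \<and> (\<forall>q\<in>ball p r \<inter> slice_plane I. F q = h q)"
      using slice_extension_eq[OF I] by blast
  qed
next
  case False
  obtain r where r: "r > 0" "ball p r \<inter> slice_plane I \<subseteq> U - \<real>"
    using open_in_slice_plane_minus_Reals(1)[OF I U(1)] U(2) False unfolding openin_contains_ball by blast
  let ?D = "ball p r \<inter> slice_plane I"
  have off: "?D \<inter> \<real> = {}" using r by blast
  show ?thesis
  proof (rule that[OF r(1)])
    show "?D \<subseteq> U \<inter> ?D" using r by blast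
    show "slice_open ?D" by (rule slice_open_off_Reals[OF I slice_disc(1) off])
    show "connectedin slice_topology ?D"
      by (rule connectedin_slice_topology[OF I Int_lower2 slice_disc(2)])
    show "\<exists>F. slice_regular_on F ?D \<and> (\<forall>q\<in>?D. F q = h q)" if "slice_holomorphic_on I h ?D" for h
      using slice_regular_off_Reals[OF I Int_lower2 off that] by blast
  qed
qed

section \<open>From a triple in one plane to slice-open sets\<close>

text \<open>\<open>U2\<close> may meet the real axis and then fail to be slice-open, so the
  extension is localised: a small disc around a point \<open>p\<close> of \<open>U2\<close> where
  the region of agreement \<open>B\<close> ends is thickened to a slice-open
  \<open>W\<close>.\<close>

lemma slice_triple_imp_not_domain:
  assumes I: "I \<in> imaginary_units" and U1: "open_in_slice_plane I U1" and U2: "open_in_slice_plane I U2"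
    and triple: "slice_triple I \<Omega> U1 U2"
  shows "\<not> domain_of_slice_regularity \<Omega>"
proof -
  note T = triple[unfolded slice_triple_def]
  have U2_sub: "U2 \<subseteq> slice_plane I" using U2 openin_subset by fastforce
  \<comment> \<open>Agreement is demanded of every extension \<open>g\<close> of \<open>f\<close>,
    so it passes to unions, and \<open>B\<close> is the largest relatively open region of
    agreement.\<close>
  define Agree where "Agree V \<longleftrightarrow> (\<forall>f g. slice_regular_on f \<Omega> \<longrightarrow> slice_holomorphic_on I g U2 \<longrightarrow>
    (\<forall>q\<in>U1. f q = g q) \<longrightarrow> (\<forall>q\<in>V. f q = g q))" for V
  define B where "B = \<Union>{V. open_in_slice_plane I V \<and> V \<subseteq> U2 \<inter> \<Omega> \<and> Agree V}"
  have B: "open_in_slice_plane I B" "B \<subseteq> U2 \<inter> \<Omega>" "Agree B"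
  proof -
    show "open_in_slice_plane I B" unfolding B_def by (intro openin_Union) blast
    show "B \<subseteq> U2 \<inter> \<Omega>" unfolding B_def by blast
    show "Agree B" unfolding B_def Agree_def by blast
  qed
  have "U1 \<subseteq> B" using U1 T unfolding B_def by (auto simp: Agree_def)
  have step: "ball p r \<inter> slice_plane I \<subseteq> B"
    if sub: "ball p r \<inter> slice_plane I \<subseteq> U2 \<inter> \<Omega>" and meets: "ball p r \<inter> slice_plane I \<inter> B \<noteq> {}" for p r
  proof -
    let ?D = "ball p r \<inter> slice_plane I"
    obtain x where x: "x \<in> ?D" "x \<in> B" using meets by blast
    have lim: "x islimpt ?D \<inter> B"
      \<comment> \<open>With both planes equal to \<open>I\<close> this only says that a point of a
        relatively open set is a limit point of it.\<close>
      using islimpt_slice_planes[of I "?D \<inter> B" x I 1] slice_disc(1) B(1) x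
      by (auto simp: openin_Int intro: islimpt_subset)
    have "Agree ?D"
      unfolding Agree_def
    proof (intro allI impI ballI)
      fix f g q
      assume f: "slice_regular_on f \<Omega>" and g: "slice_holomorphic_on I g U2" and eq: "\<forall>q\<in>U1. f q = g q"
        and q: "q \<in> ?D"
      have "slice_holomorphic_on I f (\<Omega> \<inter> slice_plane I)" using f I by (simp add: slice_regular_on_def)
      then have "slice_holomorphic_on I f ?D" "slice_holomorphic_on I g ?D"
        using sub g by (auto elim!: slice_holomorphic_on_subset)
      from slice_identity[OF I slice_disc this Int_lower1 x(1) lim _ q]
      show "f q = g q" using B(3) f g eq by (auto simp: Agree_def)
    qed
    then show ?thesis unfolding B_def using sub slice_disc(1) by blast
  qed
  obtain p where p: "p \<in> U2" and near: "\<And>r. r > 0 \<Longrightarrow> ball p r \<inter> slice_plane I \<inter> B \<noteq> {}" "p \<notin> B"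
  proof -
    \<comment> \<open>Otherwise \<open>B\<close> and \<open>U2 - B\<close> would be relatively open
      and disconnect \<open>U2\<close>: the former contains \<open>U1\<close>, the latter the points
      of \<open>U2\<close> outside \<open>\<Omega>\<close>.\<close>
    have "\<exists>p\<in>U2 - B. \<forall>r>0. ball p r \<inter> slice_plane I \<inter> B \<noteq> {}"
    proof (rule ccontr)
      assume "\<not> ?thesis"
      then have away: "\<exists>r>0. ball p r \<inter> slice_plane I \<inter> B = {}" if "p \<in> U2 - B" for p using that by blast
      have "open_in_slice_plane I (U2 - B)"
        unfolding openin_contains_ball
      proof (intro conjI ballI)
        show "U2 - B \<subseteq> slice_plane I" using U2_sub by blast
        fix p assume p: "p \<in> U2 - B"
        obtain r where r: "r > 0" "ball p r \<inter> slice_plane I \<inter> B = {}" using away[OF p] by blast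
        obtain s where s: "s > 0" "ball p s \<inter> slice_plane I \<subseteq> U2"
          using U2 p by (auto simp: openin_contains_ball)
        have "ball p (min r s) \<inter> slice_plane I \<subseteq> U2 - B" using r s by auto
        then show "\<exists>e>0. ball p e \<inter> slice_plane I \<subseteq> U2 - B" using r s by (metis min_less_iff_conj)
      qed
      moreover have "connectedin (top_of_set (slice_plane I)) U2"
        using T U2_sub by (simp add: connectedin_subtopology)
      ultimately show False
        using connectedinD[of "top_of_set (slice_plane I)" U2 B "U2 - B"] B T \<open>U1 \<subseteq> B\<close> U2_sub by blast
    qed
    then show ?thesis using that by blast
  qed
  obtain r W where W: "r > 0" "ball p r \<inter> slice_plane I \<subseteq> U2 \<inter> W"
    "slice_open W" "connectedin slice_topology W"
    and ext: "\<And>h. slice_holomorphic_on I h (ball p r \<inter> slice_plane I) \<Longrightarrow>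
      \<exists>F. slice_regular_on F W \<and> (\<forall>q\<in>ball p r \<inter> slice_plane I. F q = h q)"
    using slice_disc_thicken[OF I U2 p] by metis
  let ?D = "ball p r \<inter> slice_plane I"
  \<comment> \<open>Deleting the real axis makes this subset of a single plane slice-open without
    emptying it.\<close>
  define \<Omega>1 where "\<Omega>1 = ?D \<inter> B - \<real>"
  have "open_in_slice_plane I (?D \<inter> B)" by (intro openin_Int slice_disc(1) B(1))
  from open_in_slice_plane_minus_Reals[OF I this] near(1)[OF W(1)]
  have "open_in_slice_plane I \<Omega>1" and ne: "\<Omega>1 \<noteq> {}" by (simp_all add: \<Omega>1_def)
  then have "slice_open \<Omega>1" by (intro slice_open_off_Reals[OF I]) (auto simp: \<Omega>1_def)
  moreover have "\<Omega>1 \<subseteq> W \<inter> \<Omega>" using W(2) B(2) by (auto simp: \<Omega>1_def)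
  moreover have "p \<in> ?D" using p U2_sub W(1) by auto
  \<comment> \<open>If the disc were inside \<open>\<Omega>\<close>, \<open>step\<close> would
    absorb it into \<open>B\<close>, together with its centre \<open>p\<close>.\<close>
  then have "\<not> ?D \<subseteq> \<Omega>" using step[of p r] near W by blast
  then have "\<not> W \<subseteq> \<Omega>" using W(2) by blast
  moreover have "\<exists>F. slice_regular_on F W \<and> (\<forall>q\<in>\<Omega>1. f q = F q)" if f: "slice_regular_on f \<Omega>" for f
  proof -
    obtain g where g: "slice_holomorphic_on I g U2" "\<forall>q\<in>U1. f q = g q" using T f by blast
    have "slice_holomorphic_on I g ?D" using g(1) W(2) by (auto elim!: slice_holomorphic_on_subset)
    then obtain F where F: "slice_regular_on F W" "\<forall>q\<in>?D. F q = g q" using ext by blast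
    moreover have "\<forall>q\<in>B. f q = g q" using B(3) f g unfolding Agree_def by blast
    ultimately show ?thesis by (auto simp: \<Omega>1_def)
  qed
  ultimately show ?thesis
    unfolding domain_of_slice_regularity_def using W(3,4) ne by blast
qed

section \<open>From slice-open sets to a triple in one plane\<close>

text \<open>Slice-openness must be checked in every plane through a point, while agreement near the
  point is given in one plane only. The fact \<open>step\<close> bridges this gap, and connectedness
  of \<open>\<Omega>2\<close> then gives the contradiction.\<close>

lemma not_domain_imp_slice_triple:
  assumes \<Omega>: "slice_open \<Omega>" and not_domain: "\<not> domain_of_slice_regularity \<Omega>"
  shows "\<exists>I\<in>imaginary_units. \<exists>U1 U2. open_in_slice_plane I U1 \<and> open_in_slice_plane I U2 \<and> slice_triple I \<Omega> U1 U2"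
proof (rule ccontr)
  assume "\<not> ?thesis"
  then have no_triple: "\<not> slice_triple I \<Omega> U1 U2"
    if "I \<in> imaginary_units" "open_in_slice_plane I U1" "open_in_slice_plane I U2" for I U1 U2
    using that by blast
  from not_domain obtain \<Omega>1 \<Omega>2 where \<Omega>1: "slice_open \<Omega>1" "\<Omega>1 \<noteq> {}" "\<Omega>1 \<subseteq> \<Omega>2 \<inter> \<Omega>"
    and \<Omega>2: "slice_open \<Omega>2" "connectedin slice_topology \<Omega>2" "\<not> \<Omega>2 \<subseteq> \<Omega>"
    and ext: "\<And>f. slice_regular_on f \<Omega> \<Longrightarrow> \<exists>g. slice_regular_on g \<Omega>2 \<and> (\<forall>q\<in>\<Omega>1. f q = g q)"
    unfolding domain_of_slice_regularity_def by blast
  define Agree where "Agree V \<longleftrightarrow> (\<forall>f g. slice_regular_on f \<Omega> \<longrightarrow> slice_regular_on g \<Omega>2 \<longrightarrow>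
    (\<forall>q\<in>\<Omega>1. f q = g q) \<longrightarrow> (\<forall>q\<in>V. f q = g q))" for V
  \<comment> \<open>Each \<open>V\<close> is open in a single plane and need not be slice-open; that
    the union is slice-open is the content of \<open>open_A\<close>.\<close>
  define A where "A = \<Union>{V. \<exists>I\<in>imaginary_units. open_in_slice_plane I V \<and> V \<subseteq> \<Omega>2 \<inter> \<Omega> \<and> Agree V}"
  have A: "A \<subseteq> \<Omega>2 \<inter> \<Omega>" "Agree A"
  proof -
    show "A \<subseteq> \<Omega>2 \<inter> \<Omega>" unfolding A_def by blast
    show "Agree A" unfolding A_def Agree_def by blast
  qed
  have in_A: "V \<subseteq> A" if "I \<in> imaginary_units" "open_in_slice_plane I V" "V \<subseteq> \<Omega>2 \<inter> \<Omega>" "Agree V" for I V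
    using that unfolding A_def by blast
  \<comment> \<open>\<open>V\<close> and the disc may lie in different planes through
    \<open>x\<close>. Their common points still accumulate at \<open>x\<close>, so the identity
    theorem in the plane of \<open>J\<close> spreads agreement over the connected disc.\<close>
  have step: "ball p r \<inter> slice_plane J \<subseteq> A"
    if J: "J \<in> imaginary_units" and sub: "ball p r \<inter> slice_plane J \<subseteq> \<Omega>2 \<inter> \<Omega>"
      and V: "open_in_slice_plane I V" "V \<subseteq> A" and x: "x \<in> V" "x \<in> ball p r \<inter> slice_plane J" for I J V p r x
  proof -
    let ?D = "ball p r \<inter> slice_plane J"
    obtain s where s: "s > 0" "ball x s \<inter> slice_plane J \<subseteq> ?D"
      using slice_disc(1)[of J p r] x(2) unfolding openin_contains_ball by blast
    have "x islimpt V \<inter> (ball x s \<inter> slice_plane J)"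
      using islimpt_slice_planes[OF V(1) x(1)] x(2) s(1) by blast
    then have lim: "x islimpt V \<inter> ?D" using s(2) by (auto elim!: islimpt_subset)
    have "Agree ?D"
      unfolding Agree_def
    proof (intro allI impI ballI)
      fix f g q
      assume f: "slice_regular_on f \<Omega>" and g: "slice_regular_on g \<Omega>2" and eq: "\<forall>q\<in>\<Omega>1. f q = g q"
        and q: "q \<in> ?D"
      have "slice_holomorphic_on J f (\<Omega> \<inter> slice_plane J)" "slice_holomorphic_on J g (\<Omega>2 \<inter> slice_plane J)"
        using f g J by (simp_all add: slice_regular_on_def)
      then have "slice_holomorphic_on J f ?D" "slice_holomorphic_on J g ?D"
        using sub by (auto elim!: slice_holomorphic_on_subset)
      from slice_identity[OF J slice_disc this Int_lower2 x(2) lim _ q]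
      show "f q = g q" using A(2) V(2) f g eq unfolding Agree_def by blast
    qed
    then show ?thesis by (rule in_A[OF J slice_disc(1) sub])
  qed
  have open_A: "slice_open A"
    unfolding slice_open_def openin_contains_ball
  proof (intro ballI conjI Int_lower2)
    fix J q assume J: "J \<in> imaginary_units" and q: "q \<in> A \<inter> slice_plane J"
    then obtain I V where V: "I \<in> imaginary_units" "open_in_slice_plane I V" "V \<subseteq> \<Omega>2 \<inter> \<Omega>" "Agree V" "q \<in> V"
      unfolding A_def by blast
    have "open_in_slice_plane J ((\<Omega>2 \<inter> slice_plane J) \<inter> (\<Omega> \<inter> slice_plane J))"
      by (intro openin_Int slice_open_openin \<Omega> \<Omega>2(1) J)
    moreover have "q \<in> (\<Omega>2 \<inter> slice_plane J) \<inter> (\<Omega> \<inter> slice_plane J)" using q A(1) by blast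
    ultimately obtain r where r: "r > 0" "ball q r \<inter> slice_plane J \<subseteq> (\<Omega>2 \<inter> slice_plane J) \<inter> (\<Omega> \<inter> slice_plane J)"
      unfolding openin_contains_ball by blast
    have "ball q r \<inter> slice_plane J \<subseteq> A"
      using r q V by (intro step[OF J _ V(2) in_A[OF V(1-4)] V(5)]) auto
    then show "\<exists>e>0. ball q e \<inter> slice_plane J \<subseteq> A \<inter> slice_plane J" using r(1) by blast
  qed
  have open_compl: "slice_open (\<Omega>2 - A)"
    unfolding slice_open_def openin_contains_ball
  proof (intro ballI conjI Int_lower2)
    fix J q assume J: "J \<in> imaginary_units" and q: "q \<in> (\<Omega>2 - A) \<inter> slice_plane J"
    obtain r where r: "r > 0" "ball q r \<inter> slice_plane J \<subseteq> \<Omega>2 \<inter> slice_plane J"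
      using slice_open_openin[OF \<Omega>2(1) J] q unfolding openin_contains_ball by blast
    let ?D = "ball q r \<inter> slice_plane J"
    have "?D \<inter> A = {}"
    proof (rule ccontr)
      assume "?D \<inter> A \<noteq> {}"
      then obtain x where x: "x \<in> ?D" "x \<in> A \<inter> slice_plane J" by blast
      have AJ: "open_in_slice_plane J (A \<inter> slice_plane J)" by (rule slice_open_openin[OF open_A J])
      have oU: "open_in_slice_plane J (?D \<inter> (A \<inter> slice_plane J))"
        by (intro openin_Int slice_disc(1) AJ)
      \<comment> \<open>If the disc left \<open>\<Omega>\<close>, then its part in \<open>A\<close>
        and the disc itself would form a triple, with the extensions to \<open>\<Omega>2\<close>
        restricted to the disc.\<close>
      have "?D \<subseteq> \<Omega>"
      proof (rule ccontr)
        assume "\<not> ?D \<subseteq> \<Omega>"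
        moreover have "\<exists>g. slice_holomorphic_on J g ?D \<and> (\<forall>q\<in>?D \<inter> (A \<inter> slice_plane J). f q = g q)"
          if f: "slice_regular_on f \<Omega>" for f
        proof -
          obtain g where g: "slice_regular_on g \<Omega>2" "\<forall>q\<in>\<Omega>1. f q = g q" using ext[OF f] by blast
          have "slice_holomorphic_on J g ?D"
            using g(1) J r(2) by (auto simp: slice_regular_on_def elim!: slice_holomorphic_on_subset)
          moreover have "\<forall>q\<in>A. f q = g q" using A(2) f g unfolding Agree_def by blast
          ultimately show ?thesis by blast
        qed
        ultimately have "slice_triple J \<Omega> (?D \<inter> (A \<inter> slice_plane J)) ?D"
          unfolding slice_triple_def using x A(1) slice_disc(2) by blast
        with no_triple[OF J oU slice_disc(1)] show False by blast
      qed
      with r(2) have "?D \<subseteq> \<Omega>2 \<inter> \<Omega>" by blast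
      \<comment> \<open>Inside \<open>\<Omega>\<close>, agreement near \<open>x\<close> fills the
        whole disc and reaches its centre \<open>q\<close>, which was taken outside
        \<open>A\<close>.\<close>
      from step[OF J this AJ Int_lower1 x(2,1)] have "?D \<subseteq> A" .
      moreover have "q \<in> ?D" using q r(1) by simp
      ultimately show False using q by blast
    qed
    then show "\<exists>e>0. ball q e \<inter> slice_plane J \<subseteq> (\<Omega>2 - A) \<inter> slice_plane J" using r by blast
  qed
  have "A \<noteq> {}"
  proof -
    obtain q where q: "q \<in> \<Omega>1" using \<Omega>1(2) by blast
    obtain I where I: "I \<in> imaginary_units" "q \<in> slice_plane I" using ex_slice_plane by blast
    have "\<Omega>1 \<inter> slice_plane I \<subseteq> A"
      using \<Omega>1(3) by (intro in_A[OF I(1) slice_open_openin[OF \<Omega>1(1) I(1)]]) (auto simp: Agree_def)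
    with q I(2) show ?thesis by blast
  qed
  then show False
    using connectedinD[OF \<Omega>2(2), of A "\<Omega>2 - A"] open_A open_compl A(1) \<Omega>2(3)
    unfolding openin_slice_topology by blast
qed

theorem proposition9p4:
  fixes \<Omega> :: "quat set"
  assumes "slice_open \<Omega>"
  shows "domain_of_slice_regularity \<Omega> \<longleftrightarrow>
    (\<forall>I\<in>imaginary_units.
      \<not> (\<exists>U1 U2. open_in_slice_plane I U1 \<and> open_in_slice_plane I U2 \<and> slice_triple I \<Omega> U1 U2))"
  using slice_triple_imp_not_domain not_domain_imp_slice_triple[OF assms] by blast

end
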